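(* Let $B$ and $R$ be two $C_4$-free graphs on the same vertex set $V$, and assume that $G(B,R)$ is the complete graph on $V$. Then there exist a set $X\subseteq V$ that is a clique in $B$, a set $Y\subseteq V$ that is a clique in $R$, and a set $Z\subseteq V$ that is a clique both in $B$ and in $R$, such that $V=X\cup Y\cup Z$ and, further, every $x\in Z$ is one of the vertices of some double $C_5$ in $G(B,R)$.
   Context: All graphs are simple (no loops or multiple edges). For two graphs $B,R$ on the same vertex set $V$, $G(B,R)$ is the graph with vertex set $V$ in which two vertices are adjacent if they are adjacent in at least one of $B$ and $R$. A clique in a graph is a set of pairwise adjacent vertices (the empty set is allowed). For $S\subseteq V$, $G|S$ denotes the subgraph of $G$ induced by $S$. A graph is $H$-free if none of its induced subgraphs is isomorphic to $H$; $C_k$ is the cycle on $k$ vertices. $G(B,R)$ contains a double $C_5$ if there is a set $S\subseteq V$ of five vertices such that $B|S$ and $R|S$ are both isomorphic to $C_5$ (i.e. $S$ induces a $C_5$ in $B$ and also in $R$); the vertices of this double $C_5$ are the elements of $S$. *)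

theory Defs
  imports Main
begin

text \<open>
  A graph is given by a vertex set \<open>V\<close> (finite or infinite) and an adjacency relation \<open>E\<close>.
\<close>

definition simple_graph :: "'a set \<Rightarrow> ('a \<Rightarrow> 'a \<Rightarrow> bool) \<Rightarrow> bool" where
  "simple_graph V E \<longleftrightarrow> (\<forall>u v. E u v \<longrightarrow> u \<in> V \<and> v \<in> V) \<and> symp E \<and> irreflp E"

definition induced_adj :: "('a \<Rightarrow> 'a \<Rightarrow> bool) \<Rightarrow> 'a set \<Rightarrow> 'a \<Rightarrow> 'a \<Rightarrow> bool" where
  "induced_adj E S u v \<longleftrightarrow> u \<in> S \<and> v \<in> S \<and> E u v"

definition graph_isomorphic ::
    "'a set \<Rightarrow> ('a \<Rightarrow> 'a \<Rightarrow> bool) \<Rightarrow> 'b set \<Rightarrow> ('b \<Rightarrow> 'b \<Rightarrow> bool) \<Rightarrow> bool" where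
  "graph_isomorphic V E W F \<longleftrightarrow>
     (\<exists>f. bij_betw f V W \<and> (\<forall>u\<in>V. \<forall>v\<in>V. E u v \<longleftrightarrow> F (f u) (f v)))"

definition induced_free ::
    "'b set \<Rightarrow> ('b \<Rightarrow> 'b \<Rightarrow> bool) \<Rightarrow> 'a set \<Rightarrow> ('a \<Rightarrow> 'a \<Rightarrow> bool) \<Rightarrow> bool" where
  "induced_free W F V E \<longleftrightarrow> \<not> (\<exists>S\<subseteq>V. graph_isomorphic S (induced_adj E S) W F)"

text \<open>The cycle \<open>C\<^sub>k\<close> (for \<open>k \<ge> 3\<close>) has vertex set \<open>{..<k}\<close> and the following adjacency.\<close>

definition cycle_adj :: "nat \<Rightarrow> nat \<Rightarrow> nat \<Rightarrow> bool" where
  "cycle_adj k i j \<longleftrightarrow> i < k \<and> j < k \<and> (j = Suc i mod k \<or> i = Suc j mod k)"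

abbreviation induces_cycle :: "('a \<Rightarrow> 'a \<Rightarrow> bool) \<Rightarrow> 'a set \<Rightarrow> nat \<Rightarrow> bool" where
  "induces_cycle E S k \<equiv> graph_isomorphic S (induced_adj E S) {..<k} (cycle_adj k)"

abbreviation cycle_free :: "nat \<Rightarrow> 'a set \<Rightarrow> ('a \<Rightarrow> 'a \<Rightarrow> bool) \<Rightarrow> bool" where
  "cycle_free k V E \<equiv> induced_free {..<k} (cycle_adj k) V E"

definition union_adj ::
    "('a \<Rightarrow> 'a \<Rightarrow> bool) \<Rightarrow> ('a \<Rightarrow> 'a \<Rightarrow> bool) \<Rightarrow> 'a \<Rightarrow> 'a \<Rightarrow> bool" where
  "union_adj B R u v \<longleftrightarrow> B u v \<or> R u v"

definition clique_in :: "'a set \<Rightarrow> ('a \<Rightarrow> 'a \<Rightarrow> bool) \<Rightarrow> 'a set \<Rightarrow> bool" where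
  "clique_in V E K \<longleftrightarrow> K \<subseteq> V \<and> pairwise E K"

definition complete_graph :: "'a set \<Rightarrow> ('a \<Rightarrow> 'a \<Rightarrow> bool) \<Rightarrow> bool" where
  "complete_graph V E \<longleftrightarrow> simple_graph V E \<and> pairwise E V"

definition double_C5 ::
    "'a set \<Rightarrow> ('a \<Rightarrow> 'a \<Rightarrow> bool) \<Rightarrow> ('a \<Rightarrow> 'a \<Rightarrow> bool) \<Rightarrow> 'a set \<Rightarrow> bool" where
  "double_C5 V B R S \<longleftrightarrow>
     S \<subseteq> V \<and> card S = 5 \<and> induces_cycle B S 5 \<and> induces_cycle R S 5"

end

theory Submission
  imports Defs
begin

text \<open>
  Pass to complements: let \<open>P\<close> join two vertices that are not adjacent in \<open>B\<close>, and \<open>Q\<close> two vertices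
  that are not adjacent in \<open>R\<close>. Since \<open>C\<^sub>4\<close> is the complement of \<open>2K\<^sub>2\<close>, two \<open>P\<close>-edges are always
  joined by a \<open>P\<close>-edge or share a vertex, and likewise for \<open>Q\<close>; completeness of \<open>G(B,R)\<close> says that
  \<open>P\<close> and \<open>Q\<close> have no common edge. Cliques of \<open>B\<close> and \<open>R\<close> are the independent sets of \<open>P\<close> and \<open>Q\<close>,
  and, \<open>C\<^sub>5\<close> being self-complementary, a double \<open>C\<^sub>5\<close> is a pentagon of \<open>P\<close> whose pentagram lies in \<open>Q\<close>.

  If there is such a pentagon \<open>v\<^sub>0, \<dots>, v\<^sub>4\<close>, a vertex that sends both \<open>P\<close>- and \<open>Q\<close>-edges to it must
  be attached exactly like one of the \<open>v\<^sub>i\<close> (\<open>attached_both_ways_imp_clone\<close>). Let \<open>K\<^sub>i\<close> be the set of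
  these clones of \<open>v\<^sub>i\<close>. The clones form a blow-up of the pentagon, so \<open>K\<^sub>0 \<union> K\<^sub>2\<close> is
  \<open>P\<close>-independent, \<open>K\<^sub>3 \<union> K\<^sub>4\<close> is \<open>Q\<close>-independent and \<open>K\<^sub>1\<close> is both. A \<open>P\<close>-edge that joins two
  vertices without \<open>P\<close>-edges to the pentagon, or such a vertex to a clone, would not be joined to some
  side of the pentagon; hence these vertices can be added to the first set and, likewise, those
  without \<open>Q\<close>-edges to the pentagon to the second. Every vertex is now covered if \<open>K\<^sub>1\<close> is taken as
  \<open>Z\<close>, and a vertex of \<open>K\<^sub>1\<close> lies on the pentagon in which it replaces \<open>v\<^sub>1\<close>.

  If there is no pentagon, two sets suffice, and finding them is a 2-satisfiability problem: put each
  vertex into \<open>X\<close> or \<open>Y\<close> such that no \<open>P\<close>-edge lies in \<open>X\<close> and no \<open>Q\<close>-edge lies in \<open>Y\<close>.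
  The \<open>P\<close>-neighbours of a vertex in \<open>X\<close> must be in \<open>Y\<close>, so a vertex that is \<open>P\<close>-adjacent
  to both ends of a \<open>Q\<close>-edge cannot be in \<open>X\<close>. A vertex barred from both \<open>X\<close> and \<open>Y\<close> in
  this way lies on a pentagon (\<open>barred_twice_imp_pentagon\<close>), so no vertex is, and then any maximal
  \<open>P\<close>-independent set that respects these restrictions can be taken as \<open>X\<close>, with its complement as
  \<open>Y\<close> (\<open>partition_without_pentagon\<close>). Zorn's lemma supplies it when there are infinitely many vertices.
\<close>

section \<open>Edge-disjoint graphs without induced pairs of disjoint edges\<close>

text \<open>
  Absence of an induced \<open>2K\<^sub>2\<close> concerns disjoint edges \<open>ab\<close> and \<open>cd\<close>, but the joining condition can be
  imposed on all pairs: when the edges share a vertex, one of them is itself a joining edge.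
\<close>

locale disjoint_2K2_free =
  fixes P Q :: "'a \<Rightarrow> 'a \<Rightarrow> bool"
  assumes P_sym: "P u v \<Longrightarrow> P v u"
    and Q_sym: "Q u v \<Longrightarrow> Q v u"
    and P_irrefl: "\<not> P u u"
    and Q_irrefl: "\<not> Q u u"
    and disjoint: "P u v \<Longrightarrow> \<not> Q u v"
    and P_joined: "P a b \<Longrightarrow> P c d \<Longrightarrow> P a c \<or> P a d \<or> P b c \<or> P b d"
    and Q_joined: "Q a b \<Longrightarrow> Q c d \<Longrightarrow> Q a c \<or> Q a d \<or> Q b c \<or> Q b d"

sublocale disjoint_2K2_free \<subseteq> swap: disjoint_2K2_free Q P
proof
  show "Q u v \<Longrightarrow> \<not> P u v" for u v
    using disjoint by blast
qed (fact Q_sym P_sym Q_irrefl P_irrefl Q_joined P_joined)+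

definition independent :: "('a \<Rightarrow> 'a \<Rightarrow> bool) \<Rightarrow> 'a set \<Rightarrow> bool" where
  "independent E S \<longleftrightarrow> (\<forall>u\<in>S. \<forall>v\<in>S. \<not> E u v)"

text \<open>
  The vertex \<open>u\<close> is attached to the rest of a pentagon \<open>v0, \<dots>, v4\<close> in the same way as the corner \<open>v0\<close>,
  which itself does not enter.
\<close>

definition clone ::
    "('a \<Rightarrow> 'a \<Rightarrow> bool) \<Rightarrow> ('a \<Rightarrow> 'a \<Rightarrow> bool) \<Rightarrow> 'a \<Rightarrow> 'a \<Rightarrow> 'a \<Rightarrow> 'a \<Rightarrow> 'a \<Rightarrow> bool" where
  "clone P Q v1 v2 v3 v4 u \<longleftrightarrow> P u v1 \<and> P u v4 \<and> Q u v2 \<and> Q u v3"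

definition pentagon ::
    "('a \<Rightarrow> 'a \<Rightarrow> bool) \<Rightarrow> ('a \<Rightarrow> 'a \<Rightarrow> bool) \<Rightarrow> 'a \<Rightarrow> 'a \<Rightarrow> 'a \<Rightarrow> 'a \<Rightarrow> 'a \<Rightarrow> bool" where
  "pentagon P Q v0 v1 v2 v3 v4 \<longleftrightarrow>
     P v0 v1 \<and> P v1 v2 \<and> P v2 v3 \<and> P v3 v4 \<and> P v4 v0 \<and>
     Q v0 v2 \<and> Q v2 v4 \<and> Q v4 v1 \<and> Q v1 v3 \<and> Q v3 v0"

lemma pentagon_rotate: "pentagon P Q v0 v1 v2 v3 v4 \<Longrightarrow> pentagon P Q v1 v2 v3 v4 v0"
  unfolding pentagon_def by blast

section \<open>Partition around a pentagon\<close>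

lemma (in disjoint_2K2_free) pentagon_swap:
  "pentagon P Q v0 v1 v2 v3 v4 \<Longrightarrow> pentagon Q P v0 v2 v4 v1 v3"
  unfolding pentagon_def using P_sym Q_sym by blast

lemma (in disjoint_2K2_free) clone_swap:
  "clone P Q v1 v2 v3 v4 u \<longleftrightarrow> clone Q P v2 v4 v1 v3 u"
  unfolding clone_def by blast

lemma (in disjoint_2K2_free) clone_replaces:
  "pentagon P Q v0 v1 v2 v3 v4 \<Longrightarrow> clone P Q v1 v2 v3 v4 u \<Longrightarrow> pentagon P Q u v1 v2 v3 v4"
  unfolding pentagon_def clone_def using P_sym Q_sym by blast

text \<open>
  Compare a \<open>P\<close>-edge from \<open>u\<close> to a corner with the side opposite to that corner: no \<open>P\<close>-edge joins
  the corner to that side, so \<open>u\<close> has a \<open>P\<close>-edge to one of the ends of the side.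
\<close>

lemma (in disjoint_2K2_free) P_edge_propagates:
  assumes "pentagon P Q v0 v1 v2 v3 v4" "P u v0"
  shows "P u v2 \<or> P u v3"
  using assms P_joined[of u v0 v2 v3] disjoint Q_sym unfolding pentagon_def by blast

text \<open>
  By propagation the \<open>P\<close>-neighbours of \<open>u\<close> have no isolated member in the pentagram, and its
  \<open>Q\<close>-neighbours none in the pentagon. Two disjoint nonempty sets of this kind can only be the
  neighbourhoods of one of the corners.
\<close>

lemma (in disjoint_2K2_free) attached_both_ways_imp_clone:
  assumes C: "pentagon P Q v0 v1 v2 v3 v4"
    and p: "P u v0 \<or> P u v1 \<or> P u v2 \<or> P u v3 \<or> P u v4"
    and q: "Q u v0 \<or> Q u v1 \<or> Q u v2 \<or> Q u v3 \<or> Q u v4"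
  shows "clone P Q v1 v2 v3 v4 u \<or> clone P Q v2 v3 v4 v0 u \<or> clone P Q v3 v4 v0 v1 u
       \<or> clone P Q v4 v0 v1 v2 u \<or> clone P Q v0 v1 v2 v3 u"
proof -
  note C1 = pentagon_rotate[OF C]
  note C2 = pentagon_rotate[OF C1]
  note C3 = pentagon_rotate[OF C2]
  note C4 = pentagon_rotate[OF C3]
  have P_prop: "P u v0 \<Longrightarrow> P u v2 \<or> P u v3" "P u v1 \<Longrightarrow> P u v3 \<or> P u v4"
    "P u v2 \<Longrightarrow> P u v4 \<or> P u v0" "P u v3 \<Longrightarrow> P u v0 \<or> P u v1" "P u v4 \<Longrightarrow> P u v1 \<or> P u v2"
    using P_edge_propagates[OF C] P_edge_propagates[OF C1] P_edge_propagates[OF C2]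
      P_edge_propagates[OF C3] P_edge_propagates[OF C4] by blast+
  have Q_prop: "Q u v0 \<Longrightarrow> Q u v4 \<or> Q u v1" "Q u v1 \<Longrightarrow> Q u v0 \<or> Q u v2"
    "Q u v2 \<Longrightarrow> Q u v1 \<or> Q u v3" "Q u v3 \<Longrightarrow> Q u v2 \<or> Q u v4" "Q u v4 \<Longrightarrow> Q u v3 \<or> Q u v0"
    using swap.P_edge_propagates[OF pentagon_swap[OF C]]
      swap.P_edge_propagates[OF pentagon_swap[OF C1]]
      swap.P_edge_propagates[OF pentagon_swap[OF C2]]
      swap.P_edge_propagates[OF pentagon_swap[OF C3]]
      swap.P_edge_propagates[OF pentagon_swap[OF C4]] by blast+
  have "\<not> (P u v0 \<and> Q u v0)" "\<not> (P u v1 \<and> Q u v1)" "\<not> (P u v2 \<and> Q u v2)"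
    "\<not> (P u v3 \<and> Q u v3)" "\<not> (P u v4 \<and> Q u v4)"
    using disjoint by blast+
  with P_prop Q_prop p q show ?thesis
    unfolding clone_def by sat
qed

text \<open>
  Two clones of \<open>v0\<close> send only \<open>Q\<close>-edges to the opposite side \<open>v2 v3\<close>, so a \<open>P\<close>-edge between them
  would form an induced \<open>2K\<^sub>2\<close> with that side.
\<close>

lemma (in disjoint_2K2_free) clones_same_not_P:
  assumes "pentagon P Q v0 v1 v2 v3 v4" "clone P Q v1 v2 v3 v4 u" "clone P Q v1 v2 v3 v4 w"
  shows "\<not> P u w"
  using assms P_joined[of u w v2 v3] disjoint unfolding pentagon_def clone_def by blast

text \<open>
  A clone of \<open>v0\<close> and a clone of \<open>v2\<close> are \<open>Q\<close>-adjacent, because nothing else can join the \<open>Q\<close>-edges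
  that they send to \<open>v3\<close> and \<open>v4\<close>.
\<close>

lemma (in disjoint_2K2_free) clones_distance_two_not_P:
  assumes "pentagon P Q v0 v1 v2 v3 v4" "clone P Q v1 v2 v3 v4 u" "clone P Q v3 v4 v0 v1 w"
  shows "\<not> P u w"
proof -
  have "Q u v3" "Q w v4" "\<not> Q u v4" "\<not> Q v3 w" "\<not> Q v3 v4"
    using assms disjoint P_sym Q_sym unfolding pentagon_def clone_def by blast+
  then have "Q u w"
    using Q_joined[of u v3 w v4] by blast
  then show ?thesis
    using disjoint by blast
qed

text \<open>Again the edge \<open>uw\<close> would form an induced \<open>2K\<^sub>2\<close> with the side opposite to \<open>v0\<close>.\<close>

lemma (in disjoint_2K2_free) clone_unattached_not_P:
  assumes "pentagon P Q v0 v1 v2 v3 v4" "clone P Q v1 v2 v3 v4 u"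
    and "\<not> P w v2" "\<not> P w v3"
  shows "\<not> P u w"
  using assms P_joined[of u w v2 v3] disjoint unfolding pentagon_def clone_def by blast

lemma (in disjoint_2K2_free) independent_around_pentagon:
  assumes C: "pentagon P Q v0 v1 v2 v3 v4"
  shows "independent P ({u. clone P Q v1 v2 v3 v4 u} \<union> {u. clone P Q v3 v4 v0 v1 u}
           \<union> {u. \<not> (P u v0 \<or> P u v1 \<or> P u v2 \<or> P u v3 \<or> P u v4)})"
proof -
  note C2 = pentagon_rotate[OF pentagon_rotate[OF C]]
  have "\<not> P u w" if "\<not> P u v0" "\<not> P u v1" "\<not> P w v0" "\<not> P w v1" for u w
    using that C P_joined[of u w v0 v1] unfolding pentagon_def by blast
  then show ?thesis
    using clones_same_not_P[OF C] clones_same_not_P[OF C2] clones_distance_two_not_P[OF C]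
      clone_unattached_not_P[OF C] clone_unattached_not_P[OF C2] P_sym
    unfolding independent_def by blast
qed

lemma (in disjoint_2K2_free) partition_around_pentagon:
  assumes C: "pentagon P Q v0 v1 v2 v3 v4"
  shows "\<exists>X Y Z. independent P X \<and> independent Q Y \<and> independent P Z \<and> independent Q Z
           \<and> X \<union> Y \<union> Z = UNIV
           \<and> (\<forall>x\<in>Z. \<exists>u1 u2 u3 u4. pentagon P Q x u1 u2 u3 u4)"
proof -
  note C1 = pentagon_rotate[OF C]
  note C4 = pentagon_rotate[OF pentagon_rotate[OF pentagon_rotate[OF C1]]]
  let ?X = "{u. clone P Q v1 v2 v3 v4 u} \<union> {u. clone P Q v3 v4 v0 v1 u}
           \<union> {u. \<not> (P u v0 \<or> P u v1 \<or> P u v2 \<or> P u v3 \<or> P u v4)}"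
  let ?Y = "{u. clone P Q v4 v0 v1 v2 u} \<union> {u. clone P Q v0 v1 v2 v3 u}
           \<union> {u. \<not> (Q u v0 \<or> Q u v1 \<or> Q u v2 \<or> Q u v3 \<or> Q u v4)}"
  let ?Z = "{u. clone P Q v2 v3 v4 v0 u}"
  have X: "independent P ?X"
    by (rule independent_around_pentagon[OF C])
  \<comment> \<open>The pentagram, as a cycle of \<open>Q\<close>, reads \<open>v4, v1, v3, v0, v2\<close>; in it \<open>v4\<close> and \<open>v3\<close> are two
    steps apart, as \<open>v0\<close> and \<open>v2\<close> are in the pentagon.\<close>
  have "?Y = {u. clone Q P v1 v3 v0 v2 u} \<union> {u. clone Q P v0 v2 v4 v1 u}
           \<union> {u. \<not> (Q u v4 \<or> Q u v1 \<or> Q u v3 \<or> Q u v0 \<or> Q u v2)}"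
    unfolding clone_def by blast
  then have Y: "independent Q ?Y"
    using swap.independent_around_pentagon[OF pentagon_swap[OF C4]] by simp
  have Z: "independent P ?Z" "independent Q ?Z"
    using clones_same_not_P[OF C1] swap.clones_same_not_P[OF pentagon_swap[OF C1]]
    unfolding independent_def clone_swap[of v2] by blast+
  have "?X \<union> ?Y \<union> ?Z = UNIV"
    using attached_both_ways_imp_clone[OF C] by blast
  moreover have "\<forall>x\<in>?Z. \<exists>u1 u2 u3 u4. pentagon P Q x u1 u2 u3 u4"
    using clone_replaces[OF C1] by blast
  ultimately show ?thesis
    using X Y Z by (intro exI[of _ ?X] exI[of _ ?Y] exI[of _ ?Z] conjI)
qed

section \<open>Partition into two sets in the absence of pentagons\<close>

text \<open>
  Let \<open>X\<close> be \<open>P\<close>-independent with \<open>Q\<close>-independent complement \<open>Y\<close>. A vertex \<open>u\<close> with this property cannot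
  be in \<open>X\<close>: its \<open>P\<close>-neighbours \<open>a\<close> and \<open>b\<close> would both be in \<open>Y\<close>. With \<open>P\<close> and \<open>Q\<close> exchanged, it
  cannot be in \<open>Y\<close>.
\<close>

definition barred :: "('a \<Rightarrow> 'a \<Rightarrow> bool) \<Rightarrow> ('a \<Rightarrow> 'a \<Rightarrow> bool) \<Rightarrow> 'a \<Rightarrow> bool" where
  "barred P Q u \<longleftrightarrow> (\<exists>a b. Q a b \<and> P u a \<and> P u b)"

text \<open>
  Let \<open>Q a b\<close> and \<open>P c d\<close> witness the two restrictions. Comparing each \<open>P\<close>-edge at \<open>u\<close> with \<open>cd\<close> and
  each \<open>Q\<close>-edge at \<open>u\<close> with \<open>ab\<close>, every one of \<open>a\<close>, \<open>b\<close> has a \<open>P\<close>-edge to \<open>c\<close> or \<open>d\<close>, and every one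
  of \<open>c\<close>, \<open>d\<close> has a \<open>Q\<close>-edge to \<open>a\<close> or \<open>b\<close>. Up to exchanging \<open>c\<close> and \<open>d\<close>, these are the \<open>P\<close>-edges
  \<open>ac\<close>, \<open>bd\<close> and the \<open>Q\<close>-edges \<open>ad\<close>, \<open>bc\<close>.
\<close>

lemma (in disjoint_2K2_free) barred_twice_imp_pentagon:
  assumes "barred P Q u" "barred Q P u"
  shows "\<exists>u1 u2 u3 u4. pentagon P Q u u1 u2 u3 u4"
proof -
  obtain a b where ab: "Q a b" "P u a" "P u b"
    using assms(1) unfolding barred_def by blast
  obtain c d where cd: "P c d" "Q u c" "Q u d"
    using assms(2) unfolding barred_def by blast
  have "P a c \<or> P a d" "P b c \<or> P b d"
    using P_joined[of u a c d] P_joined[of u b c d] ab cd disjoint by blast+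
  moreover have "Q c a \<or> Q c b" "Q d a \<or> Q d b"
    using Q_joined[of u c a b] Q_joined[of u d a b] ab cd disjoint by blast+
  ultimately consider "P a c" "P b d" "Q c b" "Q d a" | "P a d" "P b c" "Q c a" "Q d b"
    using disjoint Q_sym by blast
  then show ?thesis
  proof cases
    case 1
    then have "pentagon P Q u a c d b"
      unfolding pentagon_def using ab cd P_sym Q_sym by blast
    then show ?thesis by blast
  next
    case 2
    then have "pentagon P Q u a d c b"
      unfolding pentagon_def using ab cd P_sym Q_sym by blast
    then show ?thesis by blast
  qed
qed

text \<open>
  Restrictions pass along edges: as \<open>a\<close> must be in \<open>Y\<close>, its \<open>Q\<close>-neighbour \<open>b\<close> must be in \<open>X\<close>, and a
  single triangle at \<open>b\<close> already shows this.
\<close>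

lemma (in disjoint_2K2_free) barred_propagates:
  assumes "barred P Q a" "Q a b"
  shows "barred Q P b"
proof -
  obtain c d where cd: "Q c d" "P a c" "P a d"
    using assms(1) unfolding barred_def by blast
  then have "Q b c \<or> Q b d"
    using Q_joined[of a b c d] assms(2) disjoint by blast
  then show ?thesis
    unfolding barred_def using cd assms(2) Q_sym by blast
qed

text \<open>
  Let \<open>X\<close> be a maximal \<open>P\<close>-independent set among those that contain every vertex barred from \<open>Y\<close>
  and no vertex barred from \<open>X\<close>. If a \<open>Q\<close>-edge \<open>ab\<close> were left over, then neither end is barred from
  \<open>X\<close>, by propagation, so by maximality \<open>a\<close> and \<open>b\<close> have \<open>P\<close>-neighbours \<open>x\<close> and \<open>y\<close> in \<open>X\<close>. The edges
  \<open>ax\<close> and \<open>by\<close> are joined by a \<open>P\<close>-edge, which is neither \<open>ab\<close> nor \<open>xy\<close>; so \<open>x\<close> or \<open>y\<close> sends \<open>P\<close>-edges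
  to both \<open>a\<close> and \<open>b\<close> and would be barred from \<open>X\<close>.
\<close>

lemma (in disjoint_2K2_free) partition_without_pentagon:
  assumes none: "\<And>v0 v1 v2 v3 v4. \<not> pentagon P Q v0 v1 v2 v3 v4"
  shows "\<exists>X. independent P X \<and> independent Q (- X)"
proof -
  have not_both: "\<not> (barred P Q u \<and> barred Q P u)" for u
    using barred_twice_imp_pentagon none by blast
  let ?\<A> = "{X. independent P X \<and> {u. barred Q P u} \<subseteq> X \<and> (\<forall>u\<in>X. \<not> barred P Q u)}"
  \<comment> \<open>A \<open>P\<close>-neighbour of a vertex barred from \<open>Y\<close> is barred from \<open>X\<close>, hence not also from \<open>Y\<close>.\<close>
  have "independent P {u. barred Q P u}"
    using swap.barred_propagates not_both unfolding independent_def by blast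
  then have "?\<A> \<noteq> {}"
    using not_both by blast
  moreover have "\<Union> \<C> \<in> ?\<A>" if "\<C> \<noteq> {}" "subset.chain ?\<A> \<C>" for \<C>
  proof -
    have "\<C> \<subseteq> ?\<A>" and tot: "\<And>X Y. X \<in> \<C> \<Longrightarrow> Y \<in> \<C> \<Longrightarrow> X \<subseteq> Y \<or> Y \<subseteq> X"
      using that(2) unfolding subset_chain_def by blast+
    then have mem: "independent P X" "{u. barred Q P u} \<subseteq> X" "\<forall>u\<in>X. \<not> barred P Q u"
      if "X \<in> \<C>" for X
      using that by blast+
    have "\<not> P u v" if "X \<in> \<C>" "u \<in> X" "Y \<in> \<C>" "v \<in> Y" for X Y u v
      using tot[of X Y] that mem(1) unfolding independent_def by blast
    then have "independent P (\<Union> \<C>)"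
      unfolding independent_def by blast
    then show ?thesis
      using mem(2,3) \<open>\<C> \<noteq> {}\<close> by blast
  qed
  ultimately have "\<exists>X\<in>?\<A>. \<forall>X'\<in>?\<A>. X \<subseteq> X' \<longrightarrow> X' = X"
    by (rule subset_Zorn_nonempty)
  then obtain X where "X \<in> ?\<A>" and max: "\<forall>X'\<in>?\<A>. X \<subseteq> X' \<longrightarrow> X' = X"
    by (rule bexE)
  from this(1) have X: "independent P X" "{u. barred Q P u} \<subseteq> X" "\<forall>u\<in>X. \<not> barred P Q u"
    by blast+
  have nbr: "\<exists>x\<in>X. P a x" if "a \<notin> X" "\<not> barred P Q a" for a
  proof (rule ccontr)
    assume "\<not> (\<exists>x\<in>X. P a x)"
    then have "independent P (insert a X)"
      using X(1) P_sym P_irrefl unfolding independent_def by blast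
    then have "insert a X \<in> ?\<A>"
      using X that by blast
    then show False
      using bspec[OF max, of "insert a X"] that(1) by blast
  qed
  have "\<not> Q a b" if "a \<notin> X" "b \<notin> X" for a b
  proof
    assume "Q a b"
    then have "\<not> barred P Q a" "\<not> barred P Q b"
      using barred_propagates Q_sym X(2) that by blast+
    then obtain x y where "x \<in> X" "P a x" "y \<in> X" "P b y"
      using nbr \<open>a \<notin> X\<close> \<open>b \<notin> X\<close> by blast
    moreover from this have "P a y \<or> P x b"
      using P_joined[of a x b y] \<open>Q a b\<close> disjoint X(1) unfolding independent_def by blast
    ultimately show False
      using X(3) \<open>Q a b\<close> P_sym unfolding barred_def by blast
  qed
  then show ?thesis
    using X(1) unfolding independent_def by blast
qed

lemma (in disjoint_2K2_free) partition:
  "\<exists>X Y Z. independent P X \<and> independent Q Y \<and> independent P Z \<and> independent Q Z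
     \<and> X \<union> Y \<union> Z = UNIV
     \<and> (\<forall>x\<in>Z. \<exists>u1 u2 u3 u4. pentagon P Q x u1 u2 u3 u4)"
proof (cases "\<exists>v0 v1 v2 v3 v4. pentagon P Q v0 v1 v2 v3 v4")
  case True
  then show ?thesis
    using partition_around_pentagon by blast
next
  case False
  then obtain X where "independent P X" "independent Q (- X)"
    using partition_without_pentagon by blast
  moreover have "independent E {}" for E :: "'a \<Rightarrow> 'a \<Rightarrow> bool"
    unfolding independent_def by blast
  ultimately show ?thesis
    by (intro exI[of _ X] exI[of _ "- X"] exI[of _ "{}"]) auto
qed

section \<open>Complements of graphs\<close>

definition non_adj :: "'a set \<Rightarrow> ('a \<Rightarrow> 'a \<Rightarrow> bool) \<Rightarrow> 'a \<Rightarrow> 'a \<Rightarrow> bool" where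
  "non_adj V E u v \<longleftrightarrow> u \<in> V \<and> v \<in> V \<and> u \<noteq> v \<and> \<not> E u v"

lemma induces_cycleI:
  assumes "length xs = k" "distinct xs"
    and "\<And>i j. i < k \<Longrightarrow> j < k \<Longrightarrow> E (xs ! i) (xs ! j) \<longleftrightarrow> cycle_adj k i j"
  shows "induces_cycle E (set xs) k"
proof -
  let ?f = "inv_into {..<k} ((!) xs)"
  have bij: "bij_betw ((!) xs) {..<k} (set xs)"
    using assms(1,2) by (intro bij_betw_nth) auto
  have "induced_adj E (set xs) u v \<longleftrightarrow> cycle_adj k (?f u) (?f v)"
    if "u \<in> set xs" "v \<in> set xs" for u v
  proof -
    have "?f u < k" "?f v < k" "xs ! ?f u = u" "xs ! ?f v = v"
      using that bij_betw_inv_into_right[OF bij] bij_betw_apply[OF bij_betw_inv_into[OF bij]]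
      by fastforce+
    then show ?thesis
      using assms(3)[of "?f u" "?f v"] that unfolding induced_adj_def by simp
  qed
  then show ?thesis
    using bij_betw_inv_into[OF bij] unfolding graph_isomorphic_def by blast
qed

text \<open>Otherwise \<open>a, c, b, d\<close>, in this cyclic order, would induce a \<open>C\<^sub>4\<close>, the pairs \<open>ab\<close> and \<open>cd\<close> being its non-edges.\<close>

lemma non_adj_joined:
  assumes G: "simple_graph V E" and free: "cycle_free 4 V E"
    and ab: "non_adj V E a b" and cd: "non_adj V E c d"
  shows "non_adj V E a c \<or> non_adj V E a d \<or> non_adj V E b c \<or> non_adj V E b d"
proof (rule ccontr)
  assume neg: "\<not> ?thesis"
  have sym: "E u v \<Longrightarrow> E v u" and irr: "\<not> E u u" for u v
    using G unfolding simple_graph_def by (blast dest: sympD, blast dest: irreflpD)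
  have dist: "distinct [a, c, b, d]"
    using neg ab cd sym unfolding non_adj_def by auto
  have "induces_cycle E (set [a, c, b, d]) 4"
  proof (rule induces_cycleI)
    show "E ([a, c, b, d] ! i) ([a, c, b, d] ! j) \<longleftrightarrow> cycle_adj 4 i j" if "i < 4" "j < 4" for i j
    proof -
      have "E a c" "E c b" "E b d" "E d a" "\<not> E a b" "\<not> E c d"
        using neg ab cd dist sym unfolding non_adj_def by auto
      moreover from this have "E c a" "E b c" "E d b" "E a d" "\<not> E b a" "\<not> E d c"
        using sym by blast+
      moreover have "i = 0 \<or> i = 1 \<or> i = 2 \<or> i = 3" "j = 0 \<or> j = 1 \<or> j = 2 \<or> j = 3"
        using that by auto
      ultimately show ?thesis
        using irr unfolding cycle_adj_def by (elim disjE) auto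
    qed
  qed (use dist in auto)
  moreover have "set [a, c, b, d] \<subseteq> V"
    using ab cd unfolding non_adj_def by auto
  ultimately show False
    using free unfolding induced_free_def by blast
qed

lemma induces_C5I:
  assumes "simple_graph V E" "distinct [a, b, c, d, e]"
    and "E a b" "E b c" "E c d" "E d e" "E e a"
    and "\<not> E a c" "\<not> E b d" "\<not> E c e" "\<not> E d a" "\<not> E e b"
  shows "induces_cycle E {a, b, c, d, e} 5"
proof -
  have sym: "E u v \<longleftrightarrow> E v u" and irr: "\<not> E u u" for u v
    using assms(1) unfolding simple_graph_def by (blast dest: sympD, blast dest: irreflpD)
  have "induces_cycle E (set [a, b, c, d, e]) 5"
  proof (rule induces_cycleI)
    show "E ([a, b, c, d, e] ! i) ([a, b, c, d, e] ! j) \<longleftrightarrow> cycle_adj 5 i j"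
      if "i < 5" "j < 5" for i j
    proof -
      have "E b a" "E c b" "E d c" "E e d" "E a e"
        and "\<not> E c a" "\<not> E d b" "\<not> E e c" "\<not> E a d" "\<not> E b e"
        using assms(3-) sym by blast+
      moreover have "i = 0 \<or> i = 1 \<or> i = 2 \<or> i = 3 \<or> i = 4" "j = 0 \<or> j = 1 \<or> j = 2 \<or> j = 3 \<or> j = 4"
        using that by auto
      ultimately show ?thesis
        using irr assms(3-) unfolding cycle_adj_def by (elim disjE) auto
    qed
  qed (use assms(2) in auto)
  then show ?thesis
    by simp
qed

text \<open>The sides of the pentagon induce a \<open>C\<^sub>5\<close> in \<open>R\<close>, and its diagonals induce one in \<open>B\<close>.\<close>

lemma pentagon_imp_double_C5:
  assumes B: "simple_graph V B" and R: "simple_graph V R" and K: "complete_graph V (union_adj B R)"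
    and C: "pentagon (non_adj V B) (non_adj V R) v0 v1 v2 v3 v4"
  shows "double_C5 V B R {v0, v1, v2, v3, v4}"
proof -
  have symB: "B u v \<Longrightarrow> B v u" and symR: "R u v \<Longrightarrow> R v u" for u v
    using B R unfolding simple_graph_def by (blast dest: sympD)+
  have dist: "distinct [v0, v1, v2, v3, v4]" and V: "{v0, v1, v2, v3, v4} \<subseteq> V"
    using C unfolding pentagon_def non_adj_def by auto
  have cover: "B u v \<or> R u v" if "u \<in> V" "v \<in> V" "u \<noteq> v" for u v
    using K that unfolding complete_graph_def union_adj_def pairwise_def by blast
  have nB: "\<not> B v0 v1" "\<not> B v1 v2" "\<not> B v2 v3" "\<not> B v3 v4" "\<not> B v4 v0"
    and nR: "\<not> R v0 v2" "\<not> R v2 v4" "\<not> R v4 v1" "\<not> R v1 v3" "\<not> R v3 v0"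
    using C unfolding pentagon_def non_adj_def by blast+
  have "induces_cycle R {v0, v1, v2, v3, v4} 5"
    using R dist nB nR V cover symR by (intro induces_C5I[of V]) auto
  moreover have "induces_cycle B {v0, v2, v4, v1, v3} 5"
    using B dist nB nR V cover symB by (intro induces_C5I[of V]) auto
  moreover have "{v0, v2, v4, v1, v3} = {v0, v1, v2, v3, v4}"
    by blast
  ultimately show ?thesis
    using dist V unfolding double_C5_def by simp
qed

lemma independent_non_adj_imp_clique:
  "independent (non_adj V E) S \<Longrightarrow> clique_in V E (S \<inter> V)"
  unfolding independent_def non_adj_def clique_in_def pairwise_def by blast

theorem theorem1p9:
  fixes V :: "'a set" and B R :: "'a \<Rightarrow> 'a \<Rightarrow> bool"
  assumes "simple_graph V B" and "simple_graph V R"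
    and "cycle_free 4 V B" and "cycle_free 4 V R"
    and "complete_graph V (union_adj B R)"
  shows "\<exists>X Y Z. clique_in V B X \<and> clique_in V R Y \<and> clique_in V B Z \<and> clique_in V R Z
           \<and> V = X \<union> Y \<union> Z \<and> (\<forall>x\<in>Z. \<exists>S. double_C5 V B R S \<and> x \<in> S)"
proof -
  let ?P = "non_adj V B" and ?Q = "non_adj V R"
  interpret disjoint_2K2_free ?P ?Q
  proof
    show "?P u v \<Longrightarrow> ?P v u" "?Q u v \<Longrightarrow> ?Q v u" for u v
      using assms(1,2) unfolding simple_graph_def non_adj_def by (blast dest: sympD)+
    show "\<not> ?P u u" "\<not> ?Q u u" for u
      unfolding non_adj_def by blast+
    show "?P u v \<Longrightarrow> \<not> ?Q u v" for u v
      using assms(5) unfolding complete_graph_def union_adj_def pairwise_def non_adj_def by blast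
  qed (fact non_adj_joined[OF assms(1,3)] non_adj_joined[OF assms(2,4)])+
  obtain X Y Z where indep: "independent ?P X" "independent ?Q Y" "independent ?P Z" "independent ?Q Z"
    and cover: "X \<union> Y \<union> Z = UNIV"
    and Z: "\<And>x. x \<in> Z \<Longrightarrow> \<exists>u1 u2 u3 u4. pentagon ?P ?Q x u1 u2 u3 u4"
    using partition by blast
  have "\<exists>S. double_C5 V B R S \<and> x \<in> S" if "x \<in> Z" for x
    using Z[OF that] pentagon_imp_double_C5[OF assms(1,2,5)] by blast
  moreover have "V = (X \<inter> V) \<union> (Y \<inter> V) \<union> (Z \<inter> V)"
    using cover by blast
  ultimately show ?thesis
    using indep[THEN independent_non_adj_imp_clique]
    by (intro exI[of _ "X \<inter> V"] exI[of _ "Y \<inter> V"] exI[of _ "Z \<inter> V"]) auto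
qed

end
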